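(* Let $F\in\mathbb R^{n\times n}$ have all its eigenvalues in the open right half-plane (positive real parts), let $C\in\mathbb R^{p\times n}$ and $Q=C^{T}C$, and let $X$ be the symmetric positive definite solution of the Lyapunov equation $F^{T}X+XF=Q$. Let $\alpha>0$ and $0\le\omega<2$. Let $(V_k)_{k\ge1}$, $(W_k)_{k\ge1}$ be the matrices generated by the R-GADI iteration and let $(X_k)_{k\ge0}$, with $X_0=0$, be the sequence generated by the GADI iteration (both defined in the context). Then the matrices $V_kW_k^{T}$ converge to $X$ as $k\to\infty$; and this convergence is equivalent to the convergence of the GADI sequence $\{X_k\}$ to $X$.
   Context: $I$ is the $n\times n$ identity matrix. GADI iteration with parameters $\alpha,\omega$: starting from $X_0$, for $k\ge 0$ the matrices $X_{k+\frac12}$ and $X_{k+1}$ in $\mathbb R^{n\times n}$ are determined by $$(\alpha I+F^{T})X_{k+\frac12}=X_k(\alpha I-F)+Q,$$ $$X_{k+1}(\alpha I+F)=X_k\bigl(F-(1-\omega)\alpha I\bigr)+(2-\omega)\alpha X_{k+\frac12}.$$ R-GADI (low-rank GADI) iteration with parameters $\alpha,\omega$: set $$V_1=W_1=\sqrt{(2-\omega)\alpha}\,(\alpha I+F^{T})^{-1}C^{T}\in\mathbb R^{n\times p},$$ and for $k\ge2$ define the block matrices (column-wise concatenation) $$V_k=\bigl[V_{k-1},\ \sqrt{(2-\omega)\alpha}\,(\alpha I+F^{T})^{-1}V_{k-1},\ V_1\bigr],$$ $$W_k=\bigl[(\alpha I+F^{T})^{-1}(F^{T}-(1-\omega)\alpha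 I)W_{k-1},\ \sqrt{(2-\omega)\alpha}\,(\alpha I+F^{T})^{-1}(\alpha I-F^{T})W_{k-1},\ W_1\bigr],$$ so that $V_k,W_k\in\mathbb R^{n\times(2^k-1)p}$. *)

theory Defs
  imports
    Complex_Main
    "Jordan_Normal_Form.Char_Poly"
    "Jordan_Normal_Form.Gauss_Jordan_Elimination"
begin

text \<open>Matrices are the dimension-carrying matrices of \<^theory>\<open>Jordan_Normal_Form.Matrix\<close>,
  since the number of columns of the R-GADI factors grows with the iteration index.\<close>

definition sym_pos_def_mat :: "nat \<Rightarrow> real mat \<Rightarrow> bool" where
  "sym_pos_def_mat n A \<longleftrightarrow> A \<in> carrier_mat n n \<and> transpose_mat A = A \<and>
     (\<forall>v \<in> carrier_vec n. v \<noteq> 0\<^sub>v n \<longrightarrow> v \<bullet> (A *\<^sub>v v) > 0)"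

text \<open>The type of matrices carries no topology. On real matrices of a fixed size, convergence
  in any norm is entrywise convergence.\<close>

definition mat_tendsto :: "(nat \<Rightarrow> real mat) \<Rightarrow> real mat \<Rightarrow> bool" where
  "mat_tendsto S A \<longleftrightarrow>
     (\<forall>k. S k \<in> carrier_mat (dim_row A) (dim_col A)) \<and>
     (\<forall>i < dim_row A. \<forall>j < dim_col A. (\<lambda>k. S k $$ (i, j)) \<longlonglongrightarrow> A $$ (i, j))"

text \<open>Column-wise concatenation, dual to \<^const>\<open>append_rows\<close>.\<close>

definition append_cols :: "real mat \<Rightarrow> real mat \<Rightarrow> real mat" (infixr \<open>@\<^sub>c\<close> 65) where
  "A @\<^sub>c B = four_block_mat A B (0\<^sub>m 0 (dim_col A)) (0\<^sub>m 0 (dim_col B))"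

text \<open>Only meaningful for invertible \<open>A\<close>.\<close>

definition mat_inv :: "real mat \<Rightarrow> real mat" where
  "mat_inv A = the (mat_inverse A)"

text \<open>In the following, \<open>n\<close> is the dimension of the square matrix \<open>F\<close>, and \<open>Xh k\<close> stands for the
  half step \<open>X\<^bsub>k + 1/2\<^esub>\<close>.\<close>

definition gadi_iteration ::
  "nat \<Rightarrow> real mat \<Rightarrow> real mat \<Rightarrow> real \<Rightarrow> real \<Rightarrow> (nat \<Rightarrow> real mat) \<Rightarrow> (nat \<Rightarrow> real mat) \<Rightarrow> bool" where
  "gadi_iteration n F Q \<alpha> \<omega> X Xh \<longleftrightarrow>
     (\<forall>k. X k \<in> carrier_mat n n \<and> Xh k \<in> carrier_mat n n) \<and>
     (\<forall>k. (\<alpha> \<cdot>\<^sub>m 1\<^sub>m n + transpose_mat F) * Xh k = X k * (\<alpha> \<cdot>\<^sub>m 1\<^sub>m n - F) + Q) \<and>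
     (\<forall>k. X (Suc k) * (\<alpha> \<cdot>\<^sub>m 1\<^sub>m n + F) =
            X k * (F - ((1 - \<omega>) * \<alpha>) \<cdot>\<^sub>m 1\<^sub>m n) + ((2 - \<omega>) * \<alpha>) \<cdot>\<^sub>m Xh k)"

definition rgadi_start :: "nat \<Rightarrow> real mat \<Rightarrow> real mat \<Rightarrow> real \<Rightarrow> real \<Rightarrow> real mat" where
  "rgadi_start n F C \<alpha> \<omega> =
     sqrt ((2 - \<omega>) * \<alpha>) \<cdot>\<^sub>m (mat_inv (\<alpha> \<cdot>\<^sub>m 1\<^sub>m n + transpose_mat F) * transpose_mat C)"

text \<open>The factors are indexed from 1. At index 0 we use the matrix with no columns, which agrees
  with the column count \<open>(2^k - 1) * p\<close>.\<close>

fun rgadi_V :: "nat \<Rightarrow> real mat \<Rightarrow> real mat \<Rightarrow> real \<Rightarrow> real \<Rightarrow> nat \<Rightarrow> real mat" where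
  "rgadi_V n F C \<alpha> \<omega> 0 = 0\<^sub>m n 0"
| "rgadi_V n F C \<alpha> \<omega> (Suc 0) = rgadi_start n F C \<alpha> \<omega>"
| "rgadi_V n F C \<alpha> \<omega> (Suc (Suc k)) =
     rgadi_V n F C \<alpha> \<omega> (Suc k)
     @\<^sub>c (sqrt ((2 - \<omega>) * \<alpha>) \<cdot>\<^sub>m
           (mat_inv (\<alpha> \<cdot>\<^sub>m 1\<^sub>m n + transpose_mat F) * rgadi_V n F C \<alpha> \<omega> (Suc k)))
     @\<^sub>c rgadi_start n F C \<alpha> \<omega>"

fun rgadi_W :: "nat \<Rightarrow> real mat \<Rightarrow> real mat \<Rightarrow> real \<Rightarrow> real \<Rightarrow> nat \<Rightarrow> real mat" where
  "rgadi_W n F C \<alpha> \<omega> 0 = 0\<^sub>m n 0"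
| "rgadi_W n F C \<alpha> \<omega> (Suc 0) = rgadi_start n F C \<alpha> \<omega>"
| "rgadi_W n F C \<alpha> \<omega> (Suc (Suc k)) =
     (mat_inv (\<alpha> \<cdot>\<^sub>m 1\<^sub>m n + transpose_mat F)
        * (transpose_mat F - ((1 - \<omega>) * \<alpha>) \<cdot>\<^sub>m 1\<^sub>m n) * rgadi_W n F C \<alpha> \<omega> (Suc k))
     @\<^sub>c (sqrt ((2 - \<omega>) * \<alpha>) \<cdot>\<^sub>m
           (mat_inv (\<alpha> \<cdot>\<^sub>m 1\<^sub>m n + transpose_mat F)
              * (\<alpha> \<cdot>\<^sub>m 1\<^sub>m n - transpose_mat F) * rgadi_W n F C \<alpha> \<omega> (Suc k)))
     @\<^sub>c rgadi_start n F C \<alpha> \<omega>"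

end

theory Submission
  imports Defs "Jordan_Normal_Form.Spectral_Radius"
begin

text \<open>
  Write \<open>B = (\<alpha> I + F)\<^sup>-\<^sup>1\<close>. Eliminating the half step turns GADI into the iteration of one explicit
  affine map,
  \[ X \mapsto X (F - (1-\omega)\alpha I) B + (2-\omega)\alpha\, B^T (X (\alpha I - F) + Q) B. \]

  The R-GADI products \<open>V\<^sub>k W\<^sub>k\<^sup>T\<close> are iterates of the same map: each of the three blocks of the
  factors contributes one of the three terms in the expansion of the right-hand side, since a product of concatenations is the sum of the
  products of the blocks (\<open>rgadi_product_step\<close>). Both sequences start at zero, hence
  \<open>V\<^sub>k W\<^sub>k\<^sup>T = X\<^sub>k\<close> for every \<open>k\<close>. The two convergence statements are therefore the same statement,
  and it remains to prove that GADI converges to \<open>X\<close>.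

  The Lyapunov solution \<open>X\<close> is a fixed point of the affine map, so the error \<open>E\<^sub>k = X\<^sub>k - X\<close> is
  propagated by its linear part. With the Cayley transform \<open>S = 2\<alpha>B - I = (\<alpha> I - F) B\<close> that linear
  part is a convex combination of the identity and a congruence (\<open>next_iterate_diff\<close>):
  \[ E \mapsto \frac{\omega}{2}\, E + \Bigl(1 - \frac{\omega}{2}\Bigr)\, S^T E S . \]

  The Cayley transform maps the right half-plane into the unit disc, so every eigenvalue of \<open>S\<close> has
  modulus less than 1 (\<open>cayley_spectrum\<close>) and the powers of \<open>S\<close> decay geometrically, say with
  ratio \<open>\<rho>\<close> (\<open>powers_geometric_bound\<close>). Then \<open>(S\<^sup>j)\<^sup>T E\<^sub>0 S\<^sup>j\<close> is of order \<open>\<rho>\<^bsup>2j\<^esup>\<close>, and the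
  averaging damps the errors at the rate \<open>\<omega>/2 + (1 - \<omega>/2)\<rho>\<^sup>2 < 1\<close>
  (\<open>relaxed_congruence_bound\<close>).
\<close>

declare minus_carrier_mat [simp]

section \<open>Block products and inverses\<close>

lemma append_cols_carrier:
  assumes "A \<in> carrier_mat n c" "B \<in> carrier_mat n d"
  shows "A @\<^sub>c B \<in> carrier_mat n (c + d)"
  using assms unfolding append_cols_def by (intro carrier_matI) auto

text \<open>This identity is what makes the low-rank factorization work: a sum of products of thin factors
  is again a product of thin factors.\<close>

lemma append_cols_mult_transpose:
  assumes A: "A \<in> carrier_mat n c" and B: "B \<in> carrier_mat n d"
    and A': "A' \<in> carrier_mat m c" and B': "B' \<in> carrier_mat m d"
  shows "(A @\<^sub>c B) * transpose_mat (A' @\<^sub>c B') = A * transpose_mat A' + B * transpose_mat B'"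
proof -
  have t: "transpose_mat (A' @\<^sub>c B') =
      four_block_mat (transpose_mat A') (0\<^sub>m c 0) (transpose_mat B') (0\<^sub>m d 0)"
    unfolding append_cols_def using A' B'
    by (subst transpose_four_block_mat[of _ m c _ d _ 0]) (auto simp: zero_transpose_mat)
  have "(A @\<^sub>c B) * transpose_mat (A' @\<^sub>c B') =
      four_block_mat (A * transpose_mat A' + B * transpose_mat B')
        (A * 0\<^sub>m c 0 + B * 0\<^sub>m d 0)
        (0\<^sub>m 0 c * transpose_mat A' + 0\<^sub>m 0 d * transpose_mat B')
        (0\<^sub>m 0 c * 0\<^sub>m c 0 + 0\<^sub>m 0 d * 0\<^sub>m d 0)"
    unfolding t unfolding append_cols_def using A B A' B'
    by (subst mult_four_block_mat[of _ n c _ d _ 0]) auto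
  also have "\<dots> = A * transpose_mat A' + B * transpose_mat B'"
    using A B A' B' by (intro eq_matI) auto
  finally show ?thesis .
qed

lemma mat_inv_inverts:
  assumes A: "A \<in> carrier_mat n n" and det: "det A \<noteq> 0"
  shows "mat_inv A \<in> carrier_mat n n" "A * mat_inv A = 1\<^sub>m n" "mat_inv A * A = 1\<^sub>m n"
proof -
  have "A \<in> Units (ring_mat TYPE(real) n undefined)"
    using det_non_zero_imp_unit[OF A det] .
  then obtain B where "mat_inverse A = Some B"
    using mat_inverse(1)[OF A, of undefined] by (cases "mat_inverse A") blast+
  then show "mat_inv A \<in> carrier_mat n n" "A * mat_inv A = 1\<^sub>m n" "mat_inv A * A = 1\<^sub>m n"
    using mat_inverse(2)[OF A] unfolding mat_inv_def by auto
qed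

text \<open>A singular shift would make \<open>-\<alpha>\<close> an eigenvalue, which lies in the left half-plane.\<close>

lemma det_shift_nonzero:
  assumes F: "F \<in> carrier_mat n n"
    and spec: "\<And>z. eigenvalue (map_mat complex_of_real F) z \<Longrightarrow> Re z > 0"
    and \<alpha>: "\<alpha> > 0"
  shows "det (\<alpha> \<cdot>\<^sub>m 1\<^sub>m n + F) \<noteq> 0"
proof
  assume "det (\<alpha> \<cdot>\<^sub>m 1\<^sub>m n + F) = 0"
  moreover have "char_matrix F (- \<alpha>) = \<alpha> \<cdot>\<^sub>m 1\<^sub>m n + F"
    unfolding char_matrix_def using F by (intro eq_matI) auto
  ultimately have "eigenvalue F (- \<alpha>)"
    using eigenvalue_det[OF F] by simp
  then have "eigenvalue (map_mat complex_of_real F) (complex_of_real (- \<alpha>))"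
    using of_real_hom.eigenvalue_hom[OF F] by blast
  from spec[OF this] \<alpha> show False by simp
qed

section \<open>The spectrum of the Cayley transform\<close>

lemma smult_mat_mult_vec:
  fixes A :: "'a :: comm_ring_1 mat"
  assumes "A \<in> carrier_mat nr n" "v \<in> carrier_vec n"
  shows "(c \<cdot>\<^sub>m A) *\<^sub>v v = c \<cdot>\<^sub>v (A *\<^sub>v v)"
  using assms
  by (intro eq_vecI) (auto simp: scalar_prod_def sum_distrib_left ac_simps intro!: sum.cong)

text \<open>The Cayley transform \<open>s = (a - \<mu>) / (a + \<mu>)\<close> of the spectrum is inverted by
  \<open>\<mu> = a (1 - s) / (1 + s)\<close>. If \<open>v\<close> is an eigenvector of \<open>2aB - I\<close>, then \<open>u = B v\<close> is an eigenvector
  of \<open>A\<close>: \<open>v = a u + A u\<close>, while \<open>2a u = (1 + z) v\<close> makes \<open>v\<close> a multiple of \<open>u\<close>.\<close>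

lemma cayley_eigenvalue:
  fixes A B :: "complex mat"
  assumes A: "A \<in> carrier_mat n n" and B: "B \<in> carrier_mat n n"
    and inv: "(a \<cdot>\<^sub>m 1\<^sub>m n + A) * B = 1\<^sub>m n" and a: "a \<noteq> 0"
    and ev: "eigenvalue ((2 * a) \<cdot>\<^sub>m B - 1\<^sub>m n) z"
  shows "z \<noteq> - 1" "eigenvalue A (a * (1 - z) / (1 + z))"
proof -
  from ev obtain v where v: "v \<in> carrier_vec n" "v \<noteq> 0\<^sub>v n"
    and Sv: "((2 * a) \<cdot>\<^sub>m B - 1\<^sub>m n) *\<^sub>v v = z \<cdot>\<^sub>v v"
    unfolding eigenvalue_def eigenvector_def using B by auto
  define u where "u = B *\<^sub>v v"
  have u: "u \<in> carrier_vec n" using B v unfolding u_def by auto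
  have "v = ((a \<cdot>\<^sub>m 1\<^sub>m n + A) * B) *\<^sub>v v" unfolding inv using v by simp
  also have "\<dots> = (a \<cdot>\<^sub>m 1\<^sub>m n + A) *\<^sub>v u"
    unfolding u_def using A B v by (intro assoc_mult_mat_vec[of _ n n]) auto
  also have "\<dots> = a \<cdot>\<^sub>v u + A *\<^sub>v u"
    using A u by (subst add_mult_distrib_mat_vec[of _ n n]) (auto simp: smult_mat_mult_vec[of _ n n])
  finally have vu: "v = a \<cdot>\<^sub>v u + A *\<^sub>v u" .
  have "((2 * a) \<cdot>\<^sub>m B - 1\<^sub>m n) *\<^sub>v v = (2 * a) \<cdot>\<^sub>v u - v"
    unfolding u_def using B v
    by (subst minus_mult_distrib_mat_vec[of _ n n]) (auto simp: smult_mat_mult_vec[of _ n n])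
  with Sv have Su: "z \<cdot>\<^sub>v v = (2 * a) \<cdot>\<^sub>v u - v" by simp
  have ui: "2 * a * u $ i = (1 + z) * v $ i" if "i < n" for i
    using arg_cong[OF Su, of "\<lambda>w. w $ i"] that u v by (simp add: algebra_simps)
  have vi: "v $ i = a * u $ i + (A *\<^sub>v u) $ i" if "i < n" for i
    using arg_cong[OF vu, of "\<lambda>w. w $ i"] that u A by simp
  have u0: "u \<noteq> 0\<^sub>v n" using vu v A by auto
  show z: "z \<noteq> - 1"
  proof
    assume "z = - 1"
    then have "u $ i = 0" if "i < n" for i using ui[OF that] a by simp
    with u u0 show False by (auto intro: eq_vecI)
  qed
  have "A *\<^sub>v u = (a * (1 - z) / (1 + z)) \<cdot>\<^sub>v u"
  proof (rule eq_vecI)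
    fix i assume "i < dim_vec ((a * (1 - z) / (1 + z)) \<cdot>\<^sub>v u)"
    then have i: "i < n" using u by simp
    have "1 + z \<noteq> 0" using z by (metis add.inverse_unique)
    moreover have "(1 + z) * (A *\<^sub>v u) $ i = a * (1 - z) * u $ i"
      using ui[OF i] vi[OF i] by (simp add: algebra_simps)
    ultimately show "(A *\<^sub>v u) $ i = ((a * (1 - z) / (1 + z)) \<cdot>\<^sub>v u) $ i"
      using i u by (simp add: field_simps)
  qed (use A u in auto)
  then show "eigenvalue A (a * (1 - z) / (1 + z))"
    unfolding eigenvalue_def eigenvector_def using A u u0 by auto
qed

text \<open>Multiplying numerator and denominator by the conjugate of \<open>1 + z\<close> shows that the real part has
  the sign of \<open>1 - |z|\<^sup>2\<close>.\<close>

lemma norm_less_1_if_cayley_Re_pos: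
  assumes "a > 0" "z \<noteq> - 1" "Re (complex_of_real a * (1 - z) / (1 + z)) > 0"
  shows "norm z < 1"
proof -
  have "1 + z \<noteq> 0" using assms by (metis add.inverse_unique)
  then have p: "(Re (1 + z))\<^sup>2 + (Im (1 + z))\<^sup>2 > 0"
    by (simp add: complex_neq_0)
  have "Re (complex_of_real a * (1 - z) / (1 + z))
      = a * (1 - (norm z)\<^sup>2) / ((Re (1 + z))\<^sup>2 + (Im (1 + z))\<^sup>2)"
    unfolding Re_divide cmod_power2 by (simp add: algebra_simps power2_eq_square)
  with assms p have "a * (1 - (norm z)\<^sup>2) > 0"
    by (simp add: zero_less_divide_iff)
  with \<open>a > 0\<close> have "(norm z)\<^sup>2 < 1\<^sup>2" by (simp add: zero_less_mult_iff)
  then show ?thesis by (rule power_less_imp_less_base) simp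
qed

section \<open>Powers of a matrix with spectrum in the open unit disc\<close>

lemma pow_smult_mat:
  fixes A :: "'a :: comm_ring_1 mat"
  assumes A: "A \<in> carrier_mat n n"
  shows "(c \<cdot>\<^sub>m A) ^\<^sub>m k = c ^ k \<cdot>\<^sub>m A ^\<^sub>m k"
proof (induction k)
  case 0
  show ?case using A by (auto intro: eq_matI)
next
  case (Suc k)
  then show ?case using A
    by (auto simp: mult_smult_assoc_mat[of _ n n _ n] mult_smult_distrib[of _ n n _ n] intro!: eq_matI)
qed

text \<open>For \<open>\<rho>\<close> strictly between the spectral radius and 1, the matrix \<open>A / \<rho>\<close> still has spectral radius
  less than 1. Its powers are therefore bounded, and scaling back gives the factor \<open>\<rho>\<^sup>k\<close>.\<close>

lemma powers_geometric_bound: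
  fixes A :: "complex mat"
  assumes A: "A \<in> carrier_mat n n" and ev: "\<And>z. eigenvalue A z \<Longrightarrow> norm z < 1"
  obtains \<rho> c where "0 < \<rho>" "\<rho> < 1" "\<And>k. norm_bound (A ^\<^sub>m k) (c * \<rho> ^ k)"
proof (cases "n = 0")
  \<comment> \<open>The spectral radius is a maximum over the spectrum, which is empty in dimension 0.\<close>
  case True
  then have "norm_bound (A ^\<^sub>m k) (0 * (1/2) ^ k)" for k
    using A by (auto simp: norm_bound_def)
  with that[of "1/2" 0] show thesis by auto
next
  case False
  have "spectral_radius A < 1" "0 \<le> spectral_radius A"
    using spectral_radius_mem_max(1)[OF A] False ev by (auto simp: spectrum_def)
  then obtain \<rho> where \<rho>: "spectral_radius A < \<rho>" "\<rho> < 1" "0 < \<rho>"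
    using dense[of "spectral_radius A" 1] by auto
  let ?B = "complex_of_real (1 / \<rho>) \<cdot>\<^sub>m A"
  have B: "?B \<in> carrier_mat n n" using A by simp
  have "spectral_radius ?B \<in> norm ` spectrum ?B"
    using spectral_radius_mem_max(1)[OF B] False by simp
  then obtain z where z: "eigenvalue ?B z" "spectral_radius ?B = norm z"
    unfolding spectrum_def by auto
  from z(1) obtain v where v: "v \<in> carrier_vec n" "v \<noteq> 0\<^sub>v n" "?B *\<^sub>v v = z \<cdot>\<^sub>v v"
    unfolding eigenvalue_def eigenvector_def using A by auto
  have Bv: "?B *\<^sub>v v = complex_of_real (1 / \<rho>) \<cdot>\<^sub>v (A *\<^sub>v v)"
    using A v(1) by (rule smult_mat_mult_vec)
  have "A *\<^sub>v v = (complex_of_real \<rho> * z) \<cdot>\<^sub>v v"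
    using arg_cong[OF v(3), of "\<lambda>w. complex_of_real \<rho> \<cdot>\<^sub>v w"] \<rho> unfolding Bv
    by (simp add: smult_smult_assoc)
  then have "eigenvalue A (complex_of_real \<rho> * z)"
    unfolding eigenvalue_def eigenvector_def using v A by auto
  then have "norm (complex_of_real \<rho> * z) \<le> spectral_radius A"
    using spectral_radius_mem_max(2)[OF A] False by (auto simp: spectrum_def)
  then have "\<rho> * norm z \<le> spectral_radius A" using \<rho> by (simp add: norm_mult)
  with \<rho> have "\<rho> * norm z < \<rho> * 1" by linarith
  then have "norm z < 1" using \<rho> by (simp only: mult_less_cancel_left_pos)
  then have "spectral_radius ?B < 1" using z(2) by simp
  then obtain c where c: "\<And>k. norm_bound (?B ^\<^sub>m k) c"
    using spectral_radius_jnf_norm_bound_less_1_upper_triangular[OF B] by blast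
  have "norm_bound (A ^\<^sub>m k) (c * \<rho> ^ k)" for k
  proof
    fix i j assume ij: "i < dim_row (A ^\<^sub>m k)" "j < dim_col (A ^\<^sub>m k)"
    have "?B ^\<^sub>m k = complex_of_real (1 / \<rho>) ^ k \<cdot>\<^sub>m A ^\<^sub>m k" by (rule pow_smult_mat[OF A])
    with c[of k] ij have "norm (complex_of_real (1 / \<rho>) ^ k * (A ^\<^sub>m k) $$ (i, j)) \<le> c"
      unfolding norm_bound_def by (auto simp del: of_real_divide)
    then show "norm ((A ^\<^sub>m k) $$ (i, j)) \<le> c * \<rho> ^ k"
      using \<rho> by (simp add: norm_mult norm_power norm_divide field_simps)
  qed
  with \<rho> that show thesis by blast
qed

section \<open>Averaging with a contracting congruence\<close>

lemma norm_bound_congruence: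
  fixes P E :: "'a :: real_normed_field mat"
  assumes P: "P \<in> carrier_mat n n" and E: "E \<in> carrier_mat n n"
    and bP: "norm_bound P p" and bE: "norm_bound E e"
  shows "norm_bound (transpose_mat P * E * P) (p * e * n * p * n)"
proof -
  have "norm_bound (transpose_mat P) p" using bP by (auto simp: norm_bound_def)
  then have "norm_bound (transpose_mat P * E) (p * e * of_nat n)"
    using norm_bound_mult[of "transpose_mat P" n n E n] P E bE by simp
  with norm_bound_mult[of "transpose_mat P * E" n n P n] P E bP show ?thesis by simp
qed

lemma congruence_linear:
  fixes P :: "'a :: comm_ring_1 mat"
  assumes P: "P \<in> carrier_mat n n" and M: "M \<in> carrier_mat n n" and N: "N \<in> carrier_mat n n"
  shows "transpose_mat P * (a \<cdot>\<^sub>m M + b \<cdot>\<^sub>m N) * P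
       = a \<cdot>\<^sub>m (transpose_mat P * M * P) + b \<cdot>\<^sub>m (transpose_mat P * N * P)"
  using P M N
  by (simp add: mult_add_distrib_mat[of _ n n _ n] add_mult_distrib_mat[of _ n n _ _ n]
      mult_smult_distrib[of _ n n _ n] mult_smult_assoc_mat[of _ n n _ n]
      mult_carrier_mat[of _ n n _ n])

text \<open>Nested congruences compose to a congruence with the next power of \<open>S\<close>, because \<open>S\<close> commutes with
  its powers.\<close>

lemma congruence_pow_Suc:
  fixes S :: "'a :: comm_ring_1 mat"
  assumes S: "S \<in> carrier_mat n n" and M: "M \<in> carrier_mat n n"
  shows "transpose_mat (S ^\<^sub>m j) * (transpose_mat S * M * S) * S ^\<^sub>m j
       = transpose_mat (S ^\<^sub>m Suc j) * M * S ^\<^sub>m Suc j"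
proof -
  have comm: "S * S ^\<^sub>m j = S ^\<^sub>m j * S"
  proof (induction j)
    case (Suc j)
    have "S * (S ^\<^sub>m j * S) = (S * S ^\<^sub>m j) * S"
      using S by (subst assoc_mult_mat[of _ n n _ n _ n]) auto
    then show ?case using Suc S by simp
  qed (use S in auto)
  have "transpose_mat (S * S ^\<^sub>m j) = transpose_mat (S ^\<^sub>m j) * transpose_mat S"
    using S by (intro transpose_mult[of _ n n _ n]) auto
  then show ?thesis
    using S M by (simp add: assoc_mult_mat[of _ n n _ n _ n] comm[symmetric])
qed

text \<open>The bound on \<open>E k\<close> alone (\<open>j = 0\<close>) is not inductive, since one step brings in \<open>S\<^sup>T E\<^sub>k S\<close>. Claiming
  it for the congruences by all powers of \<open>S\<close> at once closes the induction: with
  \<open>D\<^sub>j = (S\<^sup>j)\<^sup>T E\<^sub>k S\<^sup>j\<close>, a step replaces \<open>D\<^sub>j\<close> by \<open>a D\<^sub>j + b D\<^bsub>j+1\<^esub>\<close>, hence multiplies the bound by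
  \<open>a + b r\<close>. This takes the place of a binomial expansion of the \<open>k\<close>-th iterate.\<close>

lemma relaxed_congruence_bound:
  fixes S :: "real mat" and E :: "nat \<Rightarrow> real mat"
  assumes S: "S \<in> carrier_mat n n" and E: "\<And>k. E k \<in> carrier_mat n n"
    and step: "\<And>k. E (Suc k) = a \<cdot>\<^sub>m E k + b \<cdot>\<^sub>m (transpose_mat S * E k * S)"
    and ab: "0 \<le> a" "0 \<le> b"
    and init: "\<And>j. norm_bound (transpose_mat (S ^\<^sub>m j) * E 0 * S ^\<^sub>m j) (K * r ^ j)"
  shows "norm_bound (transpose_mat (S ^\<^sub>m j) * E k * S ^\<^sub>m j) (K * r ^ j * (a + b * r) ^ k)"
proof (induction k arbitrary: j)
  case 0
  show ?case using init by simp
next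
  case (Suc k)
  let ?C = "\<lambda>j. transpose_mat (S ^\<^sub>m j) * E k * S ^\<^sub>m j"
  let ?q = "K * (a + b * r) ^ k"
  have C: "?C j \<in> carrier_mat n n" for j
    using S E[of k] by (intro mult_carrier_mat[of _ n n _ n]) auto
  have "transpose_mat (S ^\<^sub>m j) * E (Suc k) * S ^\<^sub>m j
      = a \<cdot>\<^sub>m ?C j + b \<cdot>\<^sub>m (transpose_mat (S ^\<^sub>m j) * (transpose_mat S * E k * S) * S ^\<^sub>m j)"
    unfolding step using S E[of k] by (intro congruence_linear) auto
  also have "\<dots> = a \<cdot>\<^sub>m ?C j + b \<cdot>\<^sub>m ?C (Suc j)"
    using congruence_pow_Suc[OF S E] by simp
  finally have eq: "transpose_mat (S ^\<^sub>m j) * E (Suc k) * S ^\<^sub>m j = a \<cdot>\<^sub>m ?C j + b \<cdot>\<^sub>m ?C (Suc j)" .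
  show ?case unfolding eq
  proof
    fix i l assume "i < dim_row (a \<cdot>\<^sub>m ?C j + b \<cdot>\<^sub>m ?C (Suc j))"
      and "l < dim_col (a \<cdot>\<^sub>m ?C j + b \<cdot>\<^sub>m ?C (Suc j))"
    then have i: "i < n" "l < n" using C[of "Suc j"] by auto
    have b: "norm (?C j $$ (i, l)) \<le> r ^ j * ?q" for j
      using Suc[of j] C[of j] i unfolding norm_bound_def by (auto simp: ac_simps)
    have entry: "(a \<cdot>\<^sub>m M + b \<cdot>\<^sub>m N) $$ (i, l) = a * M $$ (i, l) + b * N $$ (i, l)"
      if "M \<in> carrier_mat n n" "N \<in> carrier_mat n n" for M N
      using that i by simp
    have "(a \<cdot>\<^sub>m ?C j + b \<cdot>\<^sub>m ?C (Suc j)) $$ (i, l) = a * ?C j $$ (i, l) + b * ?C (Suc j) $$ (i, l)"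
      using entry[OF C C] .
    then have "norm ((a \<cdot>\<^sub>m ?C j + b \<cdot>\<^sub>m ?C (Suc j)) $$ (i, l))
        \<le> a * norm (?C j $$ (i, l)) + b * norm (?C (Suc j) $$ (i, l))"
      using norm_triangle_ineq[of "a * ?C j $$ (i, l)" "b * ?C (Suc j) $$ (i, l)"] ab
      by (simp only: norm_mult real_norm_def abs_mult abs_of_nonneg)
    also have "\<dots> \<le> a * (r ^ j * ?q) + b * (r ^ Suc j * ?q)"
      using b[of j] b[of "Suc j"] ab by (intro add_mono mult_left_mono)
    also have "\<dots> = K * r ^ j * (a + b * r) ^ Suc k" by (simp add: algebra_simps)
    finally show "norm ((a \<cdot>\<^sub>m ?C j + b \<cdot>\<^sub>m ?C (Suc j)) $$ (i, l)) \<le> K * r ^ j * (a + b * r) ^ Suc k" .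
  qed
qed

lemma relaxed_congruence_tendsto_0:
  fixes S :: "real mat" and E :: "nat \<Rightarrow> real mat"
  assumes S: "S \<in> carrier_mat n n" and E: "\<And>k. E k \<in> carrier_mat n n"
    and step: "\<And>k. E (Suc k) = a \<cdot>\<^sub>m E k + b \<cdot>\<^sub>m (transpose_mat S * E k * S)"
    and ab: "0 \<le> a" "0 < b" "a + b = 1"
    and ev: "\<And>z. eigenvalue (map_mat complex_of_real S) z \<Longrightarrow> norm z < 1"
    and i: "i < n" "l < n"
  shows "(\<lambda>k. E k $$ (i, l)) \<longlonglongrightarrow> 0"
proof -
  let ?S = "map_mat complex_of_real S"
  have "?S \<in> carrier_mat n n" using S by simp
  then obtain \<rho> c where \<rho>: "0 < \<rho>" "\<rho> < 1" and c: "\<And>k. norm_bound (?S ^\<^sub>m k) (c * \<rho> ^ k)"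
    using powers_geometric_bound[OF _ ev] by metis
  have pow: "norm_bound (S ^\<^sub>m k) (c * \<rho> ^ k)" for k
    using c[of k] S unfolding norm_bound_def of_real_hom.mat_hom_pow[OF S, symmetric] by auto
  obtain e where e: "norm_bound (E 0) e" using norm_bound_max by blast
  define K where "K = c * e * n * c * n"
  have init: "norm_bound (transpose_mat (S ^\<^sub>m j) * E 0 * S ^\<^sub>m j) (K * (\<rho>\<^sup>2) ^ j)" for j
    using norm_bound_congruence[OF _ E[of 0] pow[of j] e] S unfolding K_def
    by (simp add: power2_eq_square power_mult_distrib ac_simps)
  have bound: "norm (E k $$ (i, l)) \<le> K * (a + b * \<rho>\<^sup>2) ^ k" for k
    using relaxed_congruence_bound[OF S E step _ _ init, where j = 0 and k = k] ab i S E[of k]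
    by (auto simp: norm_bound_def)
  have "\<rho>\<^sup>2 < 1" using \<rho> by (simp add: power_less_one_iff)
  then have "b * \<rho>\<^sup>2 < b * 1" using ab by (intro mult_strict_left_mono)
  then have "a + b * \<rho>\<^sup>2 < 1" using ab by linarith
  then have "(\<lambda>k. (a + b * \<rho>\<^sup>2) ^ k) \<longlonglongrightarrow> 0"
    using ab by (intro LIMSEQ_realpow_zero) (auto intro: add_nonneg_nonneg)
  then have "(\<lambda>k. K * (a + b * \<rho>\<^sup>2) ^ k) \<longlonglongrightarrow> 0"
    using tendsto_mult_right_zero by blast
  moreover have "(\<lambda>k. \<bar>E k $$ (i, l)\<bar>) \<longlonglongrightarrow> 0"
    by (rule tendsto_sandwich[OF _ _ tendsto_const calculation]) (use bound in auto)
  ultimately show ?thesis by (simp add: tendsto_rabs_zero_iff)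
qed

section \<open>The GADI step as an explicit affine map\<close>

locale gadi_step =
  fixes n :: nat and F B Q :: "real mat" and \<alpha> \<omega> :: real
  assumes F: "F \<in> carrier_mat n n" and B: "B \<in> carrier_mat n n" and Q_dim: "Q \<in> carrier_mat n n"
    and right_inv: "(\<alpha> \<cdot>\<^sub>m 1\<^sub>m n + F) * B = 1\<^sub>m n"
begin

definition next_iterate :: "real mat \<Rightarrow> real mat" where
  "next_iterate Y = Y * ((F - ((1 - \<omega>) * \<alpha>) \<cdot>\<^sub>m 1\<^sub>m n) * B)
     + ((2 - \<omega>) * \<alpha>) \<cdot>\<^sub>m (transpose_mat B * (Y * (\<alpha> \<cdot>\<^sub>m 1\<^sub>m n - F) + Q) * B)"

definition cayley :: "real mat" where
  "cayley = (2 * \<alpha>) \<cdot>\<^sub>m B - 1\<^sub>m n"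

text \<open>Eliminates \<open>F\<close> in favour of \<open>B\<close> in products, so that identities between step maps become linear
  relations between products with \<open>B\<close>.\<close>

lemma FB: "F * B = 1\<^sub>m n - \<alpha> \<cdot>\<^sub>m B"
proof -
  have "(\<alpha> \<cdot>\<^sub>m 1\<^sub>m n + F) * B = \<alpha> \<cdot>\<^sub>m B + F * B"
    using F B by (simp add: add_mult_distrib_mat[of _ n n _ _ n] mult_smult_assoc_mat[of _ n n _ n])
  with right_inv have e: "1\<^sub>m n = \<alpha> \<cdot>\<^sub>m B + F * B" by simp
  show ?thesis unfolding e using F B by (intro eq_matI) auto
qed

lemma transpose_inv: "transpose_mat B * (\<alpha> \<cdot>\<^sub>m 1\<^sub>m n + transpose_mat F) = 1\<^sub>m n"
proof -
  have "\<alpha> \<cdot>\<^sub>m 1\<^sub>m n + transpose_mat F = transpose_mat (\<alpha> \<cdot>\<^sub>m 1\<^sub>m n + F)"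
    using F by (intro eq_matI) auto
  then have "transpose_mat B * (\<alpha> \<cdot>\<^sub>m 1\<^sub>m n + transpose_mat F)
      = transpose_mat ((\<alpha> \<cdot>\<^sub>m 1\<^sub>m n + F) * B)"
    using F B by (simp add: transpose_mult[of _ n n _ n])
  then show ?thesis unfolding right_inv by simp
qed

lemma implicit_step:
  assumes Y: "Y \<in> carrier_mat n n" and Y': "Y' \<in> carrier_mat n n" and H: "H \<in> carrier_mat n n"
    and half: "(\<alpha> \<cdot>\<^sub>m 1\<^sub>m n + transpose_mat F) * H = Y * (\<alpha> \<cdot>\<^sub>m 1\<^sub>m n - F) + Q"
    and full: "Y' * (\<alpha> \<cdot>\<^sub>m 1\<^sub>m n + F)
      = Y * (F - ((1 - \<omega>) * \<alpha>) \<cdot>\<^sub>m 1\<^sub>m n) + ((2 - \<omega>) * \<alpha>) \<cdot>\<^sub>m H"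
  shows "Y' = next_iterate Y"
proof -
  have "H = (transpose_mat B * (\<alpha> \<cdot>\<^sub>m 1\<^sub>m n + transpose_mat F)) * H"
    unfolding transpose_inv using H by simp
  also have "\<dots> = transpose_mat B * ((\<alpha> \<cdot>\<^sub>m 1\<^sub>m n + transpose_mat F) * H)"
    using F B H by (intro assoc_mult_mat[of _ n n _ n _ n]) auto
  finally have H_eq: "H = transpose_mat B * (Y * (\<alpha> \<cdot>\<^sub>m 1\<^sub>m n - F) + Q)" unfolding half .
  have "Y' = Y' * ((\<alpha> \<cdot>\<^sub>m 1\<^sub>m n + F) * B)"
    unfolding right_inv using Y' by simp
  also have "\<dots> = (Y' * (\<alpha> \<cdot>\<^sub>m 1\<^sub>m n + F)) * B"
    using F B Y' by (intro assoc_mult_mat[of _ n n _ n _ n, symmetric]) auto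
  also have "\<dots> = Y * ((F - ((1 - \<omega>) * \<alpha>) \<cdot>\<^sub>m 1\<^sub>m n) * B) + ((2 - \<omega>) * \<alpha>) \<cdot>\<^sub>m (H * B)"
    unfolding full using F B Y H
    by (subst add_mult_distrib_mat[of _ n n _ _ n])
      (auto simp: mult_smult_assoc_mat[of _ n n _ n] assoc_mult_mat[of _ n n _ n _ n])
  finally show ?thesis unfolding next_iterate_def H_eq .
qed

text \<open>Written in \<open>B\<close> alone, the step is a linear combination of \<open>Y\<close>, \<open>Y B\<close>, \<open>B\<^sup>T Y\<close>, \<open>B\<^sup>T Y B\<close> and a
  constant, a form in which two steps can be compared coefficient by coefficient.\<close>

lemma next_iterate_expand:
  assumes Y: "Y \<in> carrier_mat n n"
  shows "next_iterate Y = Y - ((2 - \<omega>) * \<alpha>) \<cdot>\<^sub>m (Y * B)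
     + ((2 - \<omega>) * \<alpha>) \<cdot>\<^sub>m ((2 * \<alpha>) \<cdot>\<^sub>m (transpose_mat B * (Y * B)) - transpose_mat B * Y
       + transpose_mat B * (Q * B))"
proof -
  have "(F - ((1 - \<omega>) * \<alpha>) \<cdot>\<^sub>m 1\<^sub>m n) * B = F * B - ((1 - \<omega>) * \<alpha>) \<cdot>\<^sub>m B"
    using F B by (simp add: minus_mult_distrib_mat[of _ n n _ _ n] mult_smult_assoc_mat[of _ n n _ n])
  also have "\<dots> = 1\<^sub>m n - ((2 - \<omega>) * \<alpha>) \<cdot>\<^sub>m B"
    unfolding FB using B by (intro eq_matI) (auto simp: algebra_simps)
  finally have 1: "(F - ((1 - \<omega>) * \<alpha>) \<cdot>\<^sub>m 1\<^sub>m n) * B = 1\<^sub>m n - ((2 - \<omega>) * \<alpha>) \<cdot>\<^sub>m B" .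
  have "(\<alpha> \<cdot>\<^sub>m 1\<^sub>m n - F) * B = \<alpha> \<cdot>\<^sub>m B - F * B"
    using F B by (simp add: minus_mult_distrib_mat[of _ n n _ _ n] mult_smult_assoc_mat[of _ n n _ n])
  also have "\<dots> = (2 * \<alpha>) \<cdot>\<^sub>m B - 1\<^sub>m n"
    unfolding FB using B by (intro eq_matI) (auto simp: algebra_simps)
  finally have 2: "(\<alpha> \<cdot>\<^sub>m 1\<^sub>m n - F) * B = (2 * \<alpha>) \<cdot>\<^sub>m B - 1\<^sub>m n" .
  have "transpose_mat B * (Y * (\<alpha> \<cdot>\<^sub>m 1\<^sub>m n - F) + Q) * B
     = transpose_mat B * (Y * ((\<alpha> \<cdot>\<^sub>m 1\<^sub>m n - F) * B) + Q * B)"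
    using F B Y Q_dim
    by (simp add: assoc_mult_mat[of _ n n _ n _ n] add_mult_distrib_mat[of _ n n _ _ n]
       )
  also have "\<dots> = (2 * \<alpha>) \<cdot>\<^sub>m (transpose_mat B * (Y * B)) - transpose_mat B * Y + transpose_mat B * (Q * B)"
    unfolding 2 using B Y Q_dim
    by (simp add: mult_add_distrib_mat[of _ n n _ n] mult_minus_distrib_mat[of _ n n _ n]
        mult_smult_distrib[of _ n n _ n])
  finally have 3: "transpose_mat B * (Y * (\<alpha> \<cdot>\<^sub>m 1\<^sub>m n - F) + Q) * B = \<dots>" .
  have 4: "Y * (1\<^sub>m n - ((2 - \<omega>) * \<alpha>) \<cdot>\<^sub>m B) = Y - ((2 - \<omega>) * \<alpha>) \<cdot>\<^sub>m (Y * B)"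
    using B Y by (simp add: mult_minus_distrib_mat[of _ n n _ n] mult_smult_distrib[of _ n n _ n])
  show ?thesis unfolding next_iterate_def 1 3 4 ..
qed

text \<open>Expanding \<open>S\<^sup>T E S\<close> with \<open>S = 2\<alpha>B - I\<close> gives \<open>4\<alpha>\<^sup>2 B\<^sup>T E B - 2\<alpha> E B - 2\<alpha> B\<^sup>T E + E\<close>. With the weight
  \<open>1 - \<omega>/2\<close> its first three coefficients are those of the step map, as \<open>2\<alpha> (1 - \<omega>/2) = (2 - \<omega>)\<alpha>\<close>,
  and the remaining \<open>\<omega>/2\<close> of \<open>E\<close> is the identity part.\<close>

lemma next_iterate_diff:
  assumes Y: "Y \<in> carrier_mat n n" and Z: "Z \<in> carrier_mat n n"
  shows "next_iterate Y - next_iterate Z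
     = (\<omega> / 2) \<cdot>\<^sub>m (Y - Z) + (1 - \<omega> / 2) \<cdot>\<^sub>m (transpose_mat cayley * (Y - Z) * cayley)"
proof -
  let ?T = "transpose_mat B"
  have carr: "?T * (Y * B) \<in> carrier_mat n n" "?T * (Z * B) \<in> carrier_mat n n" "?T * Y \<in> carrier_mat n n"
    "?T * Z \<in> carrier_mat n n" "Y * B \<in> carrier_mat n n" "Z * B \<in> carrier_mat n n"
    "?T * (Q * B) \<in> carrier_mat n n"
    using B Y Z Q_dim by auto
  have T: "transpose_mat cayley = (2 * \<alpha>) \<cdot>\<^sub>m ?T - 1\<^sub>m n"
    unfolding cayley_def using B by (intro eq_matI) auto
  have "transpose_mat cayley * (Y - Z) * cayley = transpose_mat cayley * ((Y - Z) * cayley)"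
    unfolding cayley_def using B Y Z by (intro assoc_mult_mat[of _ n n _ n _ n]) auto
  also have "(Y - Z) * cayley = (2 * \<alpha>) \<cdot>\<^sub>m (Y * B - Z * B) - (Y - Z)"
    unfolding cayley_def using B Y Z
    by (simp add: mult_minus_distrib_mat[of _ n n _ n] minus_mult_distrib_mat[of _ n n _ _ n]
        mult_smult_distrib[of _ n n _ n])
  also have "transpose_mat cayley * \<dots> = (2 * \<alpha>) \<cdot>\<^sub>m ((2 * \<alpha>) \<cdot>\<^sub>m (?T * (Y * B) - ?T * (Z * B)) - (?T * Y - ?T * Z))
      - ((2 * \<alpha>) \<cdot>\<^sub>m (Y * B - Z * B) - (Y - Z))"
    unfolding T using B Y Z carr
    by (simp add: mult_minus_distrib_mat[of _ n n _ n] minus_mult_distrib_mat[of _ n n _ _ n]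
        mult_smult_distrib[of _ n n _ n] mult_smult_assoc_mat[of _ n n _ n])
      (intro eq_matI, auto simp: algebra_simps simp del: index_mult_mat(1))
  finally have C: "transpose_mat cayley * (Y - Z) * cayley = \<dots>" .
  show ?thesis
    unfolding C next_iterate_expand[OF Y] next_iterate_expand[OF Z]
    using carr Y Z by (intro eq_matI) (auto simp: field_simps simp del: index_mult_mat(1))
qed


lemma cayley_spectrum:
  assumes spec: "\<And>z. eigenvalue (map_mat complex_of_real F) z \<Longrightarrow> Re z > 0" and \<alpha>: "\<alpha> > 0"
    and ev: "eigenvalue (map_mat complex_of_real cayley) z"
  shows "norm z < 1"
proof -
  let ?a = "complex_of_real \<alpha>"
  let ?F = "map_mat complex_of_real F" and ?B = "map_mat complex_of_real B"
  have carr: "?F \<in> carrier_mat n n" "?B \<in> carrier_mat n n" using F B by auto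
  have shift: "map_mat complex_of_real (\<alpha> \<cdot>\<^sub>m 1\<^sub>m n + F) = ?a \<cdot>\<^sub>m 1\<^sub>m n + ?F"
    using F by (intro eq_matI) auto
  have inv: "(?a \<cdot>\<^sub>m 1\<^sub>m n + ?F) * ?B = 1\<^sub>m n"
  proof -
    have "map_mat complex_of_real ((\<alpha> \<cdot>\<^sub>m 1\<^sub>m n + F) * B)
        = map_mat complex_of_real (\<alpha> \<cdot>\<^sub>m 1\<^sub>m n + F) * ?B"
      using F B by (intro of_real_hom.mat_hom_mult[of _ n n _ n]) auto
    then show ?thesis unfolding right_inv shift of_real_hom.mat_hom_one by simp
  qed
  have cay: "map_mat complex_of_real cayley = (2 * ?a) \<cdot>\<^sub>m ?B - 1\<^sub>m n"
    unfolding cayley_def using B by (intro eq_matI) auto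
  have a0: "?a \<noteq> 0" using \<alpha> by simp
  note eig = cayley_eigenvalue[OF carr inv a0 ev[unfolded cay]]
  show ?thesis
    using norm_less_1_if_cayley_Re_pos[OF \<alpha> eig(1) spec[OF eig(2)]] .
qed

text \<open>The Lyapunov solution satisfies both implicit equations of the iteration with itself as the old
  iterate, the half step and the new iterate.\<close>

lemma lyapunov_solution_fixed:
  assumes X: "X \<in> carrier_mat n n" and lyap: "transpose_mat F * X + X * F = Q"
  shows "X = next_iterate X"
proof (rule implicit_step[OF X X X])
  have FX: "transpose_mat F * X \<in> carrier_mat n n" "X * F \<in> carrier_mat n n" using F X by auto
  show "(\<alpha> \<cdot>\<^sub>m 1\<^sub>m n + transpose_mat F) * X = X * (\<alpha> \<cdot>\<^sub>m 1\<^sub>m n - F) + Q"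
  proof -
    have l: "(\<alpha> \<cdot>\<^sub>m 1\<^sub>m n + transpose_mat F) * X = \<alpha> \<cdot>\<^sub>m X + transpose_mat F * X"
      using F X by (simp add: add_mult_distrib_mat[of _ n n _ _ n] mult_smult_assoc_mat[of _ n n _ n])
    have r: "X * (\<alpha> \<cdot>\<^sub>m 1\<^sub>m n - F) = \<alpha> \<cdot>\<^sub>m X - X * F"
      using F X by (simp add: mult_minus_distrib_mat[of _ n n _ n] mult_smult_distrib[of _ n n _ n])
    have "\<alpha> \<cdot>\<^sub>m X + U = \<alpha> \<cdot>\<^sub>m X - W + (U + W)"
      if "U \<in> carrier_mat n n" "W \<in> carrier_mat n n" for U W
      using that X by (intro eq_matI) auto
    from this[OF FX] show ?thesis unfolding l r lyap .
  qed
  show "X * (\<alpha> \<cdot>\<^sub>m 1\<^sub>m n + F) = X * (F - ((1 - \<omega>) * \<alpha>) \<cdot>\<^sub>m 1\<^sub>m n) + ((2 - \<omega>) * \<alpha>) \<cdot>\<^sub>m X"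
  proof -
    have l: "X * (\<alpha> \<cdot>\<^sub>m 1\<^sub>m n + F) = \<alpha> \<cdot>\<^sub>m X + X * F"
      using F X by (simp add: mult_add_distrib_mat[of _ n n _ n] mult_smult_distrib[of _ n n _ n])
    have r: "X * (F - ((1 - \<omega>) * \<alpha>) \<cdot>\<^sub>m 1\<^sub>m n) = X * F - ((1 - \<omega>) * \<alpha>) \<cdot>\<^sub>m X"
      using F X by (simp add: mult_minus_distrib_mat[of _ n n _ n] mult_smult_distrib[of _ n n _ n])
    have "\<alpha> \<cdot>\<^sub>m X + U = U - ((1 - \<omega>) * \<alpha>) \<cdot>\<^sub>m X + ((2 - \<omega>) * \<alpha>) \<cdot>\<^sub>m X"
      if "U \<in> carrier_mat n n" for U
      using that X by (intro eq_matI) (auto simp: algebra_simps)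
    from this[OF FX(2)] show ?thesis unfolding l r .
  qed
qed

lemma iterates_tendsto:
  assumes spec: "\<And>z. eigenvalue (map_mat complex_of_real F) z \<Longrightarrow> Re z > 0" and \<alpha>: "\<alpha> > 0"
    and \<omega>: "0 \<le> \<omega>" "\<omega> < 2"
    and Y: "\<And>k. Y k \<in> carrier_mat n n" and step: "\<And>k. Y (Suc k) = next_iterate (Y k)"
    and X: "X \<in> carrier_mat n n" and fixed: "X = next_iterate X"
  shows "mat_tendsto Y X"
  unfolding mat_tendsto_def
proof (intro conjI allI impI)
  show "Y k \<in> carrier_mat (dim_row X) (dim_col X)" for k using X Y by auto
  fix i j assume "i < dim_row X" "j < dim_col X"
  then have ij: "i < n" "j < n" using X by auto
  have cay: "cayley \<in> carrier_mat n n" unfolding cayley_def using B by simp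
  have rec: "Y (Suc k) - X
      = (\<omega> / 2) \<cdot>\<^sub>m (Y k - X) + (1 - \<omega> / 2) \<cdot>\<^sub>m (transpose_mat cayley * (Y k - X) * cayley)" for k
    using next_iterate_diff[OF Y[of k] X] unfolding step[of k] fixed[symmetric] .
  have "(\<lambda>k. (Y k - X) $$ (i, j)) \<longlonglongrightarrow> 0"
    by (rule relaxed_congruence_tendsto_0[where E = "\<lambda>k. Y k - X", OF cay _ rec _ _ _
          cayley_spectrum[OF spec \<alpha>] ij])
      (use \<omega> X in auto)
  moreover have "(Y k - X) $$ (i, j) = Y k $$ (i, j) - X $$ (i, j)" for k
    using ij X Y[of k] by simp
  ultimately show "(\<lambda>k. Y k $$ (i, j)) \<longlonglongrightarrow> X $$ (i, j)"
    by (simp add: LIM_zero_iff)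
qed

end

section \<open>The low-rank factors reproduce the GADI iterates\<close>

lemma rgadi_factor_carriers:
  assumes F: "F \<in> carrier_mat n n" and C: "C \<in> carrier_mat p n"
    and P: "mat_inv (\<alpha> \<cdot>\<^sub>m 1\<^sub>m n + transpose_mat F) \<in> carrier_mat n n"
  shows "rgadi_start n F C \<alpha> \<omega> \<in> carrier_mat n p"
    and "rgadi_V n F C \<alpha> \<omega> k \<in> carrier_mat n ((2 ^ k - 1) * p)"
    and "rgadi_W n F C \<alpha> \<omega> k \<in> carrier_mat n ((2 ^ k - 1) * p)"
proof -
  show start: "rgadi_start n F C \<alpha> \<omega> \<in> carrier_mat n p"
    unfolding rgadi_start_def using C P by simp
  have dim: "(2 ^ Suc (Suc k) - 1) * p = (2 ^ Suc k - 1) * p + ((2 ^ Suc k - 1) * p + p)" for k :: nat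
  proof -
    have "(2::nat) ^ Suc (Suc k) - 1 = (2 ^ Suc k - 1) + ((2 ^ Suc k - 1) + 1)"
      by simp
    then show ?thesis by (simp only: distrib_right mult_1)
  qed
  let ?V = "rgadi_V n F C \<alpha> \<omega>" and ?W = "rgadi_W n F C \<alpha> \<omega>"
  have "?V k \<in> carrier_mat n ((2 ^ k - 1) * p) \<and> ?W k \<in> carrier_mat n ((2 ^ k - 1) * p)"
  proof (induction k rule: induct_nat_012)
    case 0
    show ?case by simp
  next
    case 1
    show ?case using start by simp
  next
    case (ge2 k)
    then show ?case
      unfolding rgadi_V.simps rgadi_W.simps dim using F P start
      by (intro conjI append_cols_carrier smult_carrier_mat mult_carrier_mat[of _ n n]) auto
  qed
  then show "?V k \<in> carrier_mat n ((2 ^ k - 1) * p)" "?W k \<in> carrier_mat n ((2 ^ k - 1) * p)"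
    by auto
qed

text \<open>The first blocks give \<open>Y (F - (1-\<omega>)\<alpha>I) B\<close>, the second blocks give
  \<open>(2-\<omega>)\<alpha> B\<^sup>T Y (\<alpha>I - F) B\<close>, where the two square roots combine to the factor \<open>(2-\<omega>)\<alpha>\<close>, and the
  third blocks give the constant term \<open>(2-\<omega>)\<alpha> B\<^sup>T Q B\<close>. From index 0 to 1 only the third block
  is present, which is the same recursion because the product at index 0 vanishes.\<close>

lemma rgadi_product_step:
  fixes n p :: nat and F C Q B :: "real mat" and \<alpha> \<omega> :: real
  defines "Y \<equiv> \<lambda>k. rgadi_V n F C \<alpha> \<omega> k * transpose_mat (rgadi_W n F C \<alpha> \<omega> k)"
  assumes step: "gadi_step n F B Q \<alpha>" and C: "C \<in> carrier_mat p n" and Q: "Q = transpose_mat C * C"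
    and P: "mat_inv (\<alpha> \<cdot>\<^sub>m 1\<^sub>m n + transpose_mat F) = transpose_mat B"
    and c: "0 \<le> (2 - \<omega>) * \<alpha>"
  shows "Y (Suc k) = gadi_step.next_iterate n F B Q \<alpha> \<omega> (Y k)"
proof -
  interpret gadi_step n F B Q \<alpha> \<omega> by (rule step)
  let ?c = "(2 - \<omega>) * \<alpha>" and ?T = "transpose_mat B"
  let ?S = "rgadi_start n F C \<alpha> \<omega>" and ?V = "rgadi_V n F C \<alpha> \<omega>" and ?W = "rgadi_W n F C \<alpha> \<omega>"
  let ?d = "\<lambda>k. (2 ^ k - 1) * p"
  have "mat_inv (\<alpha> \<cdot>\<^sub>m 1\<^sub>m n + transpose_mat F) \<in> carrier_mat n n" unfolding P using B by simp
  note carr = rgadi_factor_carriers[OF F C this]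
  have Y: "Y k \<in> carrier_mat n n"
    unfolding Y_def using carr(2,3)[of \<omega> k] by (intro mult_carrier_mat[of _ n "?d k" _ n]) auto
  have scaled: "(sqrt ?c \<cdot>\<^sub>m M) * transpose_mat (sqrt ?c \<cdot>\<^sub>m N) = ?c \<cdot>\<^sub>m (M * transpose_mat N)"
    if "M \<in> carrier_mat n d" "N \<in> carrier_mat n d" for M N :: "real mat" and d
  proof -
    have "transpose_mat (sqrt ?c \<cdot>\<^sub>m N) = sqrt ?c \<cdot>\<^sub>m transpose_mat N" by (intro eq_matI) auto
    then have "(sqrt ?c \<cdot>\<^sub>m M) * transpose_mat (sqrt ?c \<cdot>\<^sub>m N)
        = sqrt ?c \<cdot>\<^sub>m (sqrt ?c \<cdot>\<^sub>m (M * transpose_mat N))"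
      using that by (simp add: mult_smult_distrib[of _ n d _ n] mult_smult_assoc_mat[of _ n d _ n])
    also have "\<dots> = (sqrt ?c * sqrt ?c) \<cdot>\<^sub>m (M * transpose_mat N)"
      by (intro eq_matI) auto
    finally show ?thesis using c by simp
  qed
  have SS: "?S * transpose_mat ?S = ?c \<cdot>\<^sub>m (?T * (Q * B))"
  proof -
    have "?S * transpose_mat ?S = ?c \<cdot>\<^sub>m ((?T * transpose_mat C) * transpose_mat (?T * transpose_mat C))"
      unfolding rgadi_start_def P using B C by (intro scaled) auto
    also have "transpose_mat (?T * transpose_mat C) = C * B"
      using B C by (subst transpose_mult[of _ n n _ p]) auto
    also have "(?T * transpose_mat C) * (C * B) = ?T * (Q * B)"
      unfolding Q using B C
      by (simp add: assoc_mult_mat[of _ n n _ p _ n] assoc_mult_mat[of _ n p _ n _ n]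
          mult_carrier_mat[of _ p n _ n])
    finally show ?thesis .
  qed
  show "Y (Suc k) = next_iterate (Y k)"
  proof (cases k)
    case 0
    have Y0: "Y 0 = 0\<^sub>m n n" unfolding Y_def by (intro eq_matI) (auto simp: scalar_prod_def)
    have Y1: "Y (Suc 0) = ?c \<cdot>\<^sub>m (?T * (Q * B))" unfolding Y_def using SS by simp
    have "?T * (Q * B) \<in> carrier_mat n n"
      using B Q_dim by (auto intro!: mult_carrier_mat[of _ n n _ n])
    moreover have "0\<^sub>m n n * B = 0\<^sub>m n n" "?T * 0\<^sub>m n n = 0\<^sub>m n n"
      using B by auto
    ultimately show ?thesis
      unfolding 0 Y0 Y1 next_iterate_expand[OF zero_carrier_mat]
      by (intro eq_matI) (auto simp del: index_mult_mat(1))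
  next
    case (Suc m)
    let ?A = "F - ((1 - \<omega>) * \<alpha>) \<cdot>\<^sub>m 1\<^sub>m n" and ?D = "\<alpha> \<cdot>\<^sub>m 1\<^sub>m n - F"
    let ?Vk = "?V k" and ?Wk = "?W k"
    have AT: "transpose_mat F - ((1 - \<omega>) * \<alpha>) \<cdot>\<^sub>m 1\<^sub>m n = transpose_mat ?A"
      and DT: "\<alpha> \<cdot>\<^sub>m 1\<^sub>m n - transpose_mat F = transpose_mat ?D"
      using F by (auto intro!: eq_matI)
    have A: "?A \<in> carrier_mat n n" and D: "?D \<in> carrier_mat n n" using F by auto
    have V: "?Vk \<in> carrier_mat n (?d k)" and W: "?Wk \<in> carrier_mat n (?d k)" using carr by auto
    \<comment> \<open>Transposing moves the left factors of the \<open>W\<close> recursion to the right-hand side of \<open>Y\<close>.\<close>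
    have flip: "transpose_mat (?T * transpose_mat M * ?Wk) = transpose_mat ?Wk * (M * B)"
      if "M \<in> carrier_mat n n" for M
      using that B W
      by (simp add: transpose_mult[of _ n n _ "?d k"] transpose_mult[of _ n n _ n]
          mult_carrier_mat[of _ n n _ n] del: assoc_mult_mat)
    have pull: "N * transpose_mat (?T * transpose_mat M * ?Wk) = N * transpose_mat ?Wk * (M * B)"
      if "M \<in> carrier_mat n n" "N \<in> carrier_mat n (?d k)" for M N
      unfolding flip[OF that(1)] using that B W
      by (subst assoc_mult_mat[of _ n "?d k" _ n _ n]) auto
    have "Y (Suc k) = ?Vk * transpose_mat (?T * transpose_mat ?A * ?Wk)
        + ((sqrt ?c \<cdot>\<^sub>m (?T * ?Vk)) * transpose_mat (sqrt ?c \<cdot>\<^sub>m (?T * transpose_mat ?D * ?Wk))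
        + ?S * transpose_mat ?S)"
    proof -
      have TV: "sqrt ?c \<cdot>\<^sub>m (?T * ?Vk) \<in> carrier_mat n (?d k)"
        using B V by (intro smult_carrier_mat mult_carrier_mat[of _ n n]) auto
      have TM: "?T * transpose_mat M * ?Wk \<in> carrier_mat n (?d k)"
        if "M \<in> carrier_mat n n" for M
        using that B W by (intro mult_carrier_mat[of _ n n]) auto
      note TD = smult_carrier_mat[OF TM[OF D], of "sqrt ?c"]
      note S = carr(1)[of \<omega>]
      show ?thesis
        unfolding Y_def Suc rgadi_V.simps rgadi_W.simps P AT DT
        unfolding Suc[symmetric]
          append_cols_mult_transpose[OF V append_cols_carrier[OF TV S] TM[OF A]
            append_cols_carrier[OF TD S]]
          append_cols_mult_transpose[OF TV S TD S] ..
    qed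
    also have "(sqrt ?c \<cdot>\<^sub>m (?T * ?Vk)) * transpose_mat (sqrt ?c \<cdot>\<^sub>m (?T * transpose_mat ?D * ?Wk))
        = ?c \<cdot>\<^sub>m (?T * ?Vk * transpose_mat (?T * transpose_mat ?D * ?Wk))"
      using V W D B by (intro scaled[of _ "?d k"] mult_carrier_mat[of _ n n]) auto
    also have "?T * ?Vk * transpose_mat (?T * transpose_mat ?D * ?Wk) = ?T * Y k * (?D * B)"
      unfolding Y_def using V W D B
      by (subst pull) (auto simp: assoc_mult_mat[of _ n n _ "?d k" _ n])
    also have "?Vk * transpose_mat (?T * transpose_mat ?A * ?Wk) = Y k * (?A * B)"
      unfolding Y_def by (rule pull[OF A V])
    finally have main: "Y (Suc k) = Y k * (?A * B) + (?c \<cdot>\<^sub>m (?T * Y k * (?D * B)) + ?c \<cdot>\<^sub>m (?T * (Q * B)))"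
      unfolding SS .
    have "?T * (Y k * ?D + Q) * B = ?T * Y k * (?D * B) + ?T * (Q * B)"
      using B D Q_dim Y
      by (simp add: assoc_mult_mat[of _ n n _ n _ n] add_mult_distrib_mat[of _ n n _ _ n]
          mult_add_distrib_mat[of _ n n _ n] mult_carrier_mat[of _ n n _ n])
    moreover have "?T * Y k * (?D * B) \<in> carrier_mat n n" "?T * (Q * B) \<in> carrier_mat n n"
      using B D Q_dim Y by (auto intro!: mult_carrier_mat[of _ n n _ n])
    ultimately have "?c \<cdot>\<^sub>m (?T * (Y k * ?D + Q) * B)
        = ?c \<cdot>\<^sub>m (?T * Y k * (?D * B)) + ?c \<cdot>\<^sub>m (?T * (Q * B))"
      by (simp only: add_smult_distrib_left_mat)
    then show ?thesis unfolding main next_iterate_def by simp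
  qed
qed

theorem theorem4:
  fixes n p :: nat
    and F C Q X :: "real mat"
    and \<alpha> \<omega> :: real
    and Xs Xh :: "nat \<Rightarrow> real mat"
  assumes F: "F \<in> carrier_mat n n"
    and spec: "\<And>z. eigenvalue (map_mat complex_of_real F) z \<Longrightarrow> Re z > 0"
    and C: "C \<in> carrier_mat p n"
    and Q: "Q = transpose_mat C * C"
    and X_spd: "sym_pos_def_mat n X"
    and lyapunov: "transpose_mat F * X + X * F = Q"
    and \<alpha>: "\<alpha> > 0"
    and \<omega>: "0 \<le> \<omega>" "\<omega> < 2"
    and gadi: "gadi_iteration n F Q \<alpha> \<omega> Xs Xh"
    and X0: "Xs 0 = 0\<^sub>m n n"
  shows "mat_tendsto (\<lambda>k. rgadi_V n F C \<alpha> \<omega> k * transpose_mat (rgadi_W n F C \<alpha> \<omega> k)) X \<and>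
         (mat_tendsto (\<lambda>k. rgadi_V n F C \<alpha> \<omega> k * transpose_mat (rgadi_W n F C \<alpha> \<omega> k)) X
            \<longleftrightarrow> mat_tendsto Xs X)"
proof -
  let ?G = "\<alpha> \<cdot>\<^sub>m 1\<^sub>m n + F" and ?P = "mat_inv (\<alpha> \<cdot>\<^sub>m 1\<^sub>m n + transpose_mat F)"
  let ?Y = "\<lambda>k. rgadi_V n F C \<alpha> \<omega> k * transpose_mat (rgadi_W n F C \<alpha> \<omega> k)"
  have GT: "\<alpha> \<cdot>\<^sub>m 1\<^sub>m n + transpose_mat F = transpose_mat ?G"
    using F by (intro eq_matI) auto
  have G: "?G \<in> carrier_mat n n" using F by simp
  have "det (transpose_mat ?G) \<noteq> 0"
    using det_shift_nonzero[OF F spec \<alpha>] det_transpose[OF G] by simp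
  then have P: "?P \<in> carrier_mat n n" and PG: "?P * transpose_mat ?G = 1\<^sub>m n"
    using mat_inv_inverts[of "transpose_mat ?G" n] G unfolding GT by auto
  \<comment> \<open>The factors use the inverse of the transposed shift, so \<open>B\<close> is defined from that one.\<close>
  define B where "B = transpose_mat ?P"
  have "?G * B = transpose_mat (?P * transpose_mat ?G)"
    unfolding B_def using P G by (subst transpose_mult[of _ n n _ n]) auto
  then have inv: "?G * B = 1\<^sub>m n" unfolding PG by simp
  interpret gadi_step n F B Q \<alpha> \<omega>
    using F P C Q inv unfolding B_def by unfold_locales auto
  have Xs: "Xs k \<in> carrier_mat n n" "Xs (Suc k) = next_iterate (Xs k)" for k
    using gadi implicit_step[of "Xs k" "Xs (Suc k)" "Xh k"] unfolding gadi_iteration_def by auto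
  have X: "X \<in> carrier_mat n n" using X_spd unfolding sym_pos_def_mat_def by simp
  have limit: "mat_tendsto Xs X"
    by (rule iterates_tendsto[where Y = Xs and X = X, OF spec \<alpha> \<omega> Xs X lyapunov_solution_fixed[OF X lyapunov]])
  have "?Y k = Xs k" for k
  proof (induction k)
    case 0
    show ?case unfolding X0 by (intro eq_matI) (auto simp: scalar_prod_def)
  next
    case (Suc k)
    have "?Y (Suc k) = next_iterate (?Y k)"
      using rgadi_product_step[OF gadi_step_axioms C Q] \<alpha> \<omega> unfolding B_def by simp
    with Suc Xs(2) show ?case by simp
  qed
  then have "?Y = Xs" by auto
  with limit show ?thesis by simp
qed

end
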